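(* Let $t$ and $n$ be positive integers and let $G$ be a $t$-connected sum of $n$ copies of the complete graph $K_{t+1}$. Then for every nonnegative integer $k$, $$b_k(G)=(k-1)\binom{n}{k}.$$
   Context: All graphs are simple; $K_m$ is the complete graph on $m$ vertices. For a graph $G$ with vertex set $V$ and $W\subset V$, $G|_W$ is the induced subgraph on $W$, and $\mathrm{nc}(G|_W)$ is its number of connected components (so $\mathrm{nc}(G|_\emptyset)=0$). Define $b_k(G)=\sum_{W\subset V,\,|W|=k}(\mathrm{nc}(G|_W)-1)$. Connected sum of two graphs: let $G_1,G_2$ be graphs with vertex sets $V_1,V_2$ and edge sets $E_1,E_2$; let $F_1\subset V_1$, $F_2\subset V_2$ with $|F_1|=|F_2|=t$ such that $G_1|_{F_1}$ and $G_2|_{F_2}$ are complete graphs; let $\sigma:V_2\to V_2'$ be a bijection onto a finite set $V_2'$ with $V_1\cap V_2'=F_1$ and $\sigma(F_2)=F_1$. The graph with vertex set $V_1\cup V_2'$ and edge set $E_1\cup\{\{\sigma(x),\sigma(y)\}:\{x,y\}\in E_2\}$ is called a $t$-connected sum of $G_1$ and $G_2$. A graph $G$ is a $t$-connected sum of $G_1,\ldots,G_n$ if there are graphs $G_1',\ldots,G_n'$ with $G_1'=G_1$, $G_i'$ a $t$-connected sum of $G_{i-1}'$ and $G_i$ for $i=2,\ldots,n$, and $G_n'=G$. *)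

theory Defs
  imports Complex_Main "HOL-Library.Ramsey"
begin

record 'a sgraph =
  verts :: "'a set"
  edges :: "'a set set"

definition simple_graph :: "'a sgraph \<Rightarrow> bool" where
  "simple_graph G \<longleftrightarrow> finite (verts G) \<and> edges G \<subseteq> nsets (verts G) 2"

definition complete_graph :: "'a sgraph \<Rightarrow> bool" where
  "complete_graph G \<longleftrightarrow> finite (verts G) \<and> edges G = nsets (verts G) 2"

text \<open>\<open>is_K m G\<close>: the graph \<open>G\<close> is a copy of the complete graph on \<open>m\<close> vertices.\<close>

definition is_K :: "nat \<Rightarrow> 'a sgraph \<Rightarrow> bool" where
  "is_K m G \<longleftrightarrow> complete_graph G \<and> card (verts G) = m"

text \<open>Only meant for \<open>W \<subseteq> verts G\<close>.\<close>

definition induced :: "'a sgraph \<Rightarrow> 'a set \<Rightarrow> 'a sgraph" where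
  "induced G W = \<lparr>verts = W, edges = {e \<in> edges G. e \<subseteq> W}\<rparr>"

definition joined :: "'a sgraph \<Rightarrow> ('a \<times> 'a) set" where
  "joined G = {(u, v). u \<in> verts G \<and> v \<in> verts G \<and>
                       (u, v) \<in> {(x, y). {x, y} \<in> edges G}\<^sup>*}"

definition components :: "'a sgraph \<Rightarrow> 'a set set" where
  "components G = verts G // joined G"

definition nc :: "'a sgraph \<Rightarrow> nat" where
  "nc G = card (components G)"

text \<open>Integer-valued: the empty set contributes \<open>-1\<close> when \<open>k = 0\<close>.\<close>

definition bnum :: "nat \<Rightarrow> 'a sgraph \<Rightarrow> int" where
  "bnum k G = (\<Sum>W | W \<subseteq> verts G \<and> card W = k. int (nc (induced G W)) - 1)"

definition connected_sum :: "nat \<Rightarrow> 'a sgraph \<Rightarrow> 'b sgraph \<Rightarrow> 'a sgraph \<Rightarrow> bool" where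
  "connected_sum t G1 G2 G \<longleftrightarrow>
     simple_graph G1 \<and> simple_graph G2 \<and>
     (\<exists>F1 F2 V2' \<sigma>.
        F1 \<subseteq> verts G1 \<and> F2 \<subseteq> verts G2 \<and> card F1 = t \<and> card F2 = t \<and>
        complete_graph (induced G1 F1) \<and> complete_graph (induced G2 F2) \<and>
        bij_betw \<sigma> (verts G2) V2' \<and> verts G1 \<inter> V2' = F1 \<and> \<sigma> ` F2 = F1 \<and>
        G = \<lparr>verts = verts G1 \<union> V2',
             edges = edges G1 \<union> {{\<sigma> x, \<sigma> y} |x y. {x, y} \<in> edges G2}\<rparr>)"

text \<open>
  The summands are \<open>Gs 1, \<dots>, Gs n\<close>; other values of \<open>Gs\<close> are irrelevant. Taking the summands
  in the vertex type of the result loses no generality, since each of them may be replaced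
  by its image under the bijection used to glue it on.
\<close>

definition iterated_connected_sum ::
    "nat \<Rightarrow> nat \<Rightarrow> (nat \<Rightarrow> 'a sgraph) \<Rightarrow> 'a sgraph \<Rightarrow> bool" where
  "iterated_connected_sum t n Gs G \<longleftrightarrow> n \<ge> 1 \<and>
     (\<exists>G'. G' 1 = Gs 1 \<and>
           (\<forall>i\<in>{2..n}. connected_sum t (G' (i - 1)) (Gs i) (G' i)) \<and>
           G' n = G)"

end

theory Submission
  imports Defs
begin

text \<open>
  Gluing a copy of \<open>K\<^sub>t\<^sub>+\<^sub>1\<close> along a \<open>t\<close>-clique \<open>N\<close> adds one vertex \<open>v\<close> with neighbourhood \<open>N\<close>.
  For a set \<open>W\<close> of old vertices, adding \<open>v\<close> to \<open>W\<close> leaves the number of components unchanged if \<open>W\<close>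
  meets \<open>N\<close>, because \<open>N\<close> is a clique, and otherwise creates one new component. As exactly \<open>n\<close> of
  the \<open>t + n\<close> old vertices lie outside \<open>N\<close>, this yields the recursion
  \<open>b\<^sub>k\<^sub>+\<^sub>1(G') = b\<^sub>k\<^sub>+\<^sub>1(G) + b\<^sub>k(G) + (n choose k)\<close>, which is solved by \<open>(k - 1) (n choose k)\<close>.
\<close>

section \<open>Vertex extension, and equivalence classes when a set gains one point\<close>

definition add_vertex :: "'a \<Rightarrow> 'a set \<Rightarrow> 'a sgraph \<Rightarrow> 'a sgraph" where
  "add_vertex v N G = \<lparr>verts = insert v (verts G), edges = edges G \<union> (\<lambda>f. {v, f}) ` N\<rparr>"

text \<open>The class of \<open>v\<close> is that of \<open>f\<close>, so every class of
  \<open>r'\<close> has a representative in \<open>A\<close>; hence intersecting with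
  \<open>A\<close> maps the classes of \<open>r'\<close> bijectively to those of
  \<open>r\<close>.\<close>

lemma card_quotient_insert_related:
  assumes r: "equiv A r" and r': "equiv (insert v A) r'" and "v \<notin> A"
    and restr: "r = r' \<inter> A \<times> A" and f: "f \<in> A" "(v, f) \<in> r'"
  shows "card (insert v A // r') = card (A // r)"
proof (rule bij_betw_same_card)
  have cls: "r' `` {x} \<inter> A = r `` {x}" if "x \<in> A" for x
    using that restr by auto
  have vf: "r' `` {v} = r' `` {f}"
    using equiv_class_eq[OF r' f(2)] .
  have q: "insert v A // r' = (\<lambda>x. r' `` {x}) ` A"
    using vf f(1) by (auto simp: quotient_def)
  show "bij_betw (\<lambda>X. X \<inter> A) (insert v A // r') (A // r)"
    unfolding bij_betw_def
  proof
    show "inj_on (\<lambda>X. X \<inter> A) (insert v A // r')"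
    proof (rule inj_onI)
      fix X Y assume "X \<in> insert v A // r'" "Y \<in> insert v A // r'" and eq: "X \<inter> A = Y \<inter> A"
      then obtain x y where x: "x \<in> A" "X = r' `` {x}" and y: "y \<in> A" "Y = r' `` {y}"
        unfolding q by auto
      \<comment> \<open>Equal traces on \<open>A\<close> put the representative \<open>x\<close> of
        \<open>X\<close> into \<open>Y\<close> as well, so the two classes share a point.\<close>
      have "x \<in> X \<inter> A"
        using x equiv_class_self[OF r', of x] by simp
      then have "(y, x) \<in> r'"
        using eq y by auto
      then show "X = Y"
        using equiv_class_eq[OF r'] x y by simp
    qed
    have "(\<lambda>X. X \<inter> A) ` (insert v A // r') = (\<lambda>x. r `` {x}) ` A"
      unfolding q image_image using cls by (intro image_cong) auto
    then show "(\<lambda>X. X \<inter> A) ` (insert v A // r') = A // r"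
      by (auto simp: quotient_def)
  qed
qed

text \<open>\<open>v\<close> forms a class by itself, and the remaining classes are exactly those of
  \<open>r\<close>.\<close>

lemma card_quotient_insert_isolated:
  assumes "finite A" and r: "equiv A r" and r': "equiv (insert v A) r'" and "v \<notin> A"
    and restr: "r = r' \<inter> A \<times> A" and iso: "\<And>f. f \<in> A \<Longrightarrow> (v, f) \<notin> r'"
  shows "card (insert v A // r') = Suc (card (A // r))"
proof -
  have sub: "r' \<subseteq> insert v A \<times> insert v A" and "sym r'" and "(v, v) \<in> r'"
    using r' by (auto simp: equiv_def refl_on_def)
  then have "r' `` {v} = {v}"
    using iso by auto
  \<comment> \<open>Symmetry of \<open>r'\<close> turns \<open>iso\<close> around, so the class of a
    point of \<open>A\<close> does not contain \<open>v\<close>.\<close>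
  moreover have "r' `` {x} = r `` {x}" if "x \<in> A" for x
    using that restr sub iso \<open>sym r'\<close> by (auto dest: symD)
  ultimately have "insert v A // r' = insert {v} (A // r)"
    by (auto simp: quotient_def)
  moreover have "{v} \<notin> A // r"
    using in_quotient_imp_subset[OF r] \<open>v \<notin> A\<close> by blast
  moreover have "finite (A // r)"
    using \<open>finite A\<close> finite_quotient r by (metis equiv_type)
  ultimately show ?thesis
    by simp
qed

section \<open>Components after a vertex is attached to a clique\<close>

lemma equiv_joined: "equiv (verts G) (joined G)"
proof (rule equivI)
  have "sym ({(x, y). {x, y} \<in> edges G}\<^sup>*)"
    by (rule sym_rtrancl) (auto simp: sym_def insert_commute)
  then show "sym (joined G)"
    unfolding joined_def by (auto simp: sym_def)
  show "trans (joined G)"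
    unfolding joined_def by (auto simp: trans_def)
qed (auto simp: joined_def refl_on_def)

context
  fixes G :: "'a sgraph" and v :: 'a and N :: "'a set"
  assumes simple: "simple_graph G" and new: "v \<notin> verts G"
    and nbrs: "N \<subseteq> verts G" and clique: "nsets N 2 \<subseteq> edges G"
begin

lemma simple_graph_add_vertex: "simple_graph (add_vertex v N G)"
  using simple new nbrs unfolding simple_graph_def add_vertex_def
  by (auto simp: nsets_def card_insert_if)

lemma induced_add_vertex_edge_iff:
  assumes "W \<subseteq> verts G"
  shows "{x, y} \<in> edges (induced (add_vertex v N G) (insert v W)) \<longleftrightarrow>
    {x, y} \<in> edges (induced G W) \<or> x = v \<and> y \<in> N \<inter> W \<or> y = v \<and> x \<in> N \<inter> W"
proof -
  \<comment> \<open>No edge of \<open>G\<close> contains \<open>v\<close>, so an edge of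
    \<open>G\<close> inside \<open>insert v W\<close> already lies inside \<open>W\<close>.\<close>
  have "e \<subseteq> verts G" if "e \<in> edges G" for e
    using simple that unfolding simple_graph_def nsets_def by auto
  then show ?thesis
    using assms new nbrs unfolding induced_def add_vertex_def
    by (auto simp: doubleton_eq_iff)
qed

text \<open>The induction along the path has to survive a visit to \<open>v\<close>. The vertex
  before \<open>v\<close> lies in the clique \<open>N\<close>, so it reaches all of
  \<open>N \<inter> W\<close> inside \<open>W\<close>; this is what is recorded for paths ending at
  \<open>v\<close>, and it covers whichever neighbour the path visits next.\<close>

lemma reachable_add_vertex:
  assumes "W \<subseteq> verts G"
    and "(x, y) \<in> {(x, y). {x, y} \<in> edges (induced (add_vertex v N G) (insert v W))}\<^sup>*"
    and "x \<in> W"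
  shows "if y = v then \<forall>f \<in> N \<inter> W. (x, f) \<in> {(x, y). {x, y} \<in> edges (induced G W)}\<^sup>*
    else (x, y) \<in> {(x, y). {x, y} \<in> edges (induced G W)}\<^sup>*"
  using assms(2)
proof induction
  case base
  then show ?case
    using assms new by auto
next
  case (step y z)
  let ?E = "{(x, y). {x, y} \<in> edges (induced G W)}"
  have nv: "\<And>a b. {a, b} \<in> edges (induced G W) \<Longrightarrow> a \<noteq> v \<and> b \<noteq> v"
    using assms new unfolding induced_def by auto
  consider "{y, z} \<in> edges (induced G W)" | "y = v" "z \<in> N \<inter> W" | "z = v" "y \<in> N \<inter> W"
    using step(2) induced_add_vertex_edge_iff[OF assms(1)] by blast
  then show ?case
  proof cases
    case 1
    then show ?thesis
      using nv[OF 1] step(3) by (auto intro: rtrancl_into_rtrancl)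
  next
    case 2
    then show ?thesis
      using step(3) new nbrs by auto
  next
    case 3
    then have y: "(x, y) \<in> ?E\<^sup>*"
      using step(3) new nbrs by (auto split: if_splits)
    have "(x, f) \<in> ?E\<^sup>*" if f: "f \<in> N \<inter> W" for f
    proof (cases "f = y")
      case False
      then have "{y, f} \<in> nsets N 2"
        using 3 f by (auto simp: nsets_def)
      then have "(y, f) \<in> ?E"
        using 3 f clique by (auto simp: induced_def)
      then show ?thesis
        using y by (rule rtrancl_into_rtrancl[rotated])
    qed (use y in simp)
    then show ?thesis
      using 3 by simp
  qed
qed

text \<open>A detour through \<open>v\<close> can be replaced by a clique edge, so \<open>v\<close>
  merges no two old components. This supplies the assumption \<open>restr\<close> of both lemmas on
  quotients.\<close>

lemma joined_induced_add_vertex: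
  assumes "W \<subseteq> verts G"
  shows "joined (induced G W) = joined (induced (add_vertex v N G) (insert v W)) \<inter> W \<times> W"
proof -
  let ?E = "{(x, y). {x, y} \<in> edges (induced G W)}"
  let ?E' = "{(x, y). {x, y} \<in> edges (induced (add_vertex v N G) (insert v W))}"
  have "?E \<subseteq> ?E'"
    using induced_add_vertex_edge_iff[OF assms] by auto
  then have "?E\<^sup>* \<subseteq> ?E'\<^sup>*"
    by (rule rtrancl_mono)
  moreover have "(x, y) \<in> ?E\<^sup>*" if "(x, y) \<in> ?E'\<^sup>*" "x \<in> W" "y \<in> W" for x y
    using reachable_add_vertex[OF assms that(1,2)] that(3) assms new by (auto split: if_splits)
  moreover have "verts (induced G W) = W" "verts (induced (add_vertex v N G) (insert v W)) = insert v W"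
    by (simp_all add: induced_def)
  ultimately show ?thesis
    unfolding joined_def by auto
qed

lemma nc_induced_add_vertex:
  assumes "W \<subseteq> verts G"
  shows "nc (induced (add_vertex v N G) (insert v W)) =
    nc (induced G W) + (if W \<inter> N = {} then 1 else 0)"
proof -
  let ?r = "joined (induced G W)"
  let ?r' = "joined (induced (add_vertex v N G) (insert v W))"
  let ?E' = "{(x, y). {x, y} \<in> edges (induced (add_vertex v N G) (insert v W))}"
  have vs: "verts (induced H U) = U" for H :: "'a sgraph" and U
    by (simp add: induced_def)
  have r: "equiv W ?r" and r': "equiv (insert v W) ?r'"
    using equiv_joined[of "induced G W"]
      equiv_joined[of "induced (add_vertex v N G) (insert v W)"] by (simp_all add: vs)
  have vW: "v \<notin> W" and finW: "finite W"
    using assms new simple finite_subset unfolding simple_graph_def by auto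
  note edge = induced_add_vertex_edge_iff[OF assms]
  show ?thesis
  proof (cases "W \<inter> N = {}")
    case True
    \<comment> \<open>With \<open>W \<inter> N\<close> empty, no edge of the enlarged induced graph
      contains \<open>v\<close>, so a path from \<open>v\<close> never leaves it.\<close>
    have stuck: "y = v" if "(v, y) \<in> ?E'\<^sup>*" for y
      using that
    proof induction
      case (step y z)
      have "{v, z} \<notin> edges (induced G W)"
        using vW by (auto simp: induced_def)
      with step True edge[of v z] vW show ?case
        by blast
    qed simp
    have iso: "(v, f) \<notin> ?r'" if "f \<in> W" for f
      using stuck that vW unfolding joined_def by auto
    show ?thesis
      using card_quotient_insert_isolated[OF finW r r' vW joined_induced_add_vertex[OF assms] iso] True
      by (simp add: nc_def components_def vs)
  next
    case False
    then obtain f where f: "f \<in> W" "f \<in> N"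
      by blast
    then have "(v, f) \<in> ?E'"
      using edge[of v f] by simp
    then have "(v, f) \<in> ?r'"
      using f unfolding joined_def by (auto simp: vs)
    from card_quotient_insert_related[OF r r' vW joined_induced_add_vertex[OF assms] f(1) this] False
    show ?thesis
      by (simp add: nc_def components_def vs)
  qed
qed

section \<open>Recursion for \<open>bnum\<close>\<close>

lemma induced_add_vertex_old:
  assumes "W \<subseteq> verts G"
  shows "induced (add_vertex v N G) W = induced G W"
  using assms new by (auto simp: induced_def add_vertex_def)

text \<open>Sets of size \<open>Suc k\<close> without \<open>v\<close> give
  \<open>bnum (Suc k) G\<close>. Removing \<open>v\<close> from the others leaves the sets of size
  \<open>k\<close>, which give \<open>bnum k G\<close> and one extra unit for each set that avoids
  \<open>N\<close>; the binomial coefficient counts these.\<close>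

lemma bnum_add_vertex:
  "bnum (Suc k) (add_vertex v N G) =
    bnum (Suc k) G + bnum k G + int ((card (verts G) - card N) choose k)"
proof -
  let ?V = "verts G" and ?G' = "add_vertex v N G"
  let ?A = "{W. W \<subseteq> ?V \<and> card W = Suc k}" and ?B = "{W. W \<subseteq> ?V \<and> card W = k}"
  let ?h = "\<lambda>H W. int (nc (induced H W)) - 1"
  have fin: "finite ?V"
    using simple by (simp add: simple_graph_def)
  have finAB: "finite ?A" "finite ?B"
    using fin by simp_all
  have split: "{W. W \<subseteq> verts ?G' \<and> card W = Suc k} = ?A \<union> insert v ` ?B" (is "?L = ?R")
  proof
    show "?L \<subseteq> ?R"
    proof
      fix W assume W: "W \<in> ?L"
      \<comment> \<open>An infinite set has \<open>card\<close> 0, which is not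
        \<open>Suc k\<close>.\<close>
      then have "finite W"
        using card.infinite by fastforce
      show "W \<in> ?R"
      proof (cases "v \<in> W")
        case True
        then have "W - {v} \<in> ?B" "W = insert v (W - {v})"
          using W \<open>finite W\<close> by (auto simp: add_vertex_def)
        then show ?thesis
          by blast
      next
        case False
        then show ?thesis
          using W by (auto simp: add_vertex_def)
      qed
    qed
    have "card (insert v W) = Suc k" if "W \<in> ?B" for W
    proof -
      have "finite W" "v \<notin> W"
        using that fin new finite_subset by auto
      then show ?thesis
        using that by simp
    qed
    then show "?R \<subseteq> ?L"
      by (auto simp: add_vertex_def)
  qed
  have inj: "inj_on (insert v) ?B"
    using new by (intro inj_onI) (metis (mono_tags, lifting) insert_ident mem_Collect_eq subsetD)
  have "bnum (Suc k) ?G' = sum (?h ?G') ?A + sum (?h ?G') (insert v ` ?B)"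
    unfolding bnum_def split using finAB new by (intro sum.union_disjoint) auto
  also have "sum (?h ?G') ?A = bnum (Suc k) G"
    unfolding bnum_def by (intro sum.cong) (auto simp: induced_add_vertex_old)
  also have "sum (?h ?G') (insert v ` ?B) = (\<Sum>W\<in>?B. ?h G W + (if W \<inter> N = {} then 1 else 0))"
    unfolding sum.reindex[OF inj] o_def
    by (intro sum.cong) (auto simp: nc_induced_add_vertex)
  also have "\<dots> = bnum k G + int (card {W \<in> ?B. W \<inter> N = {}})"
    using finAB by (simp add: sum.distrib bnum_def sum.If_cases Int_def)
  also have "{W \<in> ?B. W \<inter> N = {}} = {W. W \<subseteq> ?V - N \<and> card W = k}"
    by auto
  also have "card \<dots> = (card ?V - card N) choose k"
    using n_subsets[of "?V - N" k] fin nbrs by (simp add: card_Diff_subset finite_subset)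
  finally show ?thesis
    by simp
qed

end

section \<open>The value at \<open>k = 0\<close> and the values for complete graphs\<close>

lemma bnum_0:
  assumes "finite (verts G)"
  shows "bnum 0 G = - 1"
proof -
  \<comment> \<open>Finiteness of \<open>verts G\<close> rules out infinite \<open>W\<close>, whose
    \<open>card\<close> would also be 0.\<close>
  have "{W. W \<subseteq> verts G \<and> card W = 0} = {{}}"
    using assms finite_subset by fastforce
  then show ?thesis
    by (simp add: bnum_def nc_def components_def induced_def)
qed

lemma nc_complete_graph:
  assumes "nsets W 2 \<subseteq> edges G" "W \<noteq> {}"
  shows "nc (induced G W) = 1"
proof -
  have "(x, y) \<in> joined (induced G W)" if "x \<in> W" "y \<in> W" for x y
  proof (cases "x = y")
    case False
    then have "{x, y} \<in> nsets W 2"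
      using that by (simp add: nsets_def)
    then have "(x, y) \<in> {(x, y). {x, y} \<in> edges (induced G W)}"
      using that assms(1) by (auto simp: induced_def)
    then show ?thesis
      using that by (simp add: joined_def induced_def r_into_rtrancl)
  qed (use that in \<open>simp add: joined_def induced_def\<close>)
  moreover have "joined (induced G W) \<subseteq> W \<times> W"
    by (auto simp: joined_def induced_def)
  ultimately have "joined (induced G W) = W \<times> W"
    by auto
  then have "components (induced G W) = {W}"
    using assms(2) by (auto simp: components_def quotient_def induced_def)
  then show ?thesis
    by (simp add: nc_def)
qed

lemma bnum_complete_graph:
  assumes "complete_graph G" "k > 0"
  shows "bnum k G = 0"
  unfolding bnum_def
proof (rule sum.neutral, clarify)
  fix W assume W: "W \<subseteq> verts G" "k = card W"
  \<comment> \<open>\<open>k > 0\<close> excludes the empty set, whose term would be -1.\<close>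
  then have "nsets W 2 \<subseteq> edges G" "W \<noteq> {}"
    using assms nsets_mono[of W "verts G" 2] by (auto simp: complete_graph_def)
  then show "int (nc (induced G W)) - 1 = 0"
    by (simp add: nc_complete_graph)
qed

section \<open>Gluing on a complete graph as a vertex extension\<close>

text \<open>\<open>F2\<close> omits exactly one vertex \<open>w\<close> of \<open>G2\<close>, and
  its image under the gluing map is the new vertex \<open>v\<close>. Edges inside \<open>F2\<close>
  land on edges that the clique \<open>F1\<close> already has in \<open>G1\<close>, so only the
  edges at \<open>w\<close> are new, and \<open>N\<close> is \<open>F1\<close>.\<close>

lemma connected_sum_complete_graphE:
  assumes "connected_sum t G1 G2 G" and "is_K (t + 1) G2"
  obtains v N where "v \<notin> verts G1" "N \<subseteq> verts G1" "card N = t" "nsets N 2 \<subseteq> edges G1"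
    "G = add_vertex v N G1"
proof -
  from assms(1) obtain F1 F2 V2' \<sigma> where
      F: "F1 \<subseteq> verts G1" "F2 \<subseteq> verts G2" "card F1 = t" "card F2 = t"
    and compl: "complete_graph (induced G1 F1)"
    and \<sigma>: "bij_betw \<sigma> (verts G2) V2'" "verts G1 \<inter> V2' = F1" "\<sigma> ` F2 = F1"
    and G: "G = \<lparr>verts = verts G1 \<union> V2',
             edges = edges G1 \<union> {{\<sigma> x, \<sigma> y} |x y. {x, y} \<in> edges G2}\<rparr>"
    unfolding connected_sum_def by blast
  have fin2: "finite (verts G2)" and e2: "edges G2 = nsets (verts G2) 2"
    and c2: "card (verts G2) = t + 1"
    using assms(2) by (auto simp: is_K_def complete_graph_def)
  have V2': "V2' = \<sigma> ` verts G2" and inj: "inj_on \<sigma> (verts G2)"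
    using \<sigma>(1) by (auto simp: bij_betw_def)
  have "card (verts G2 - F2) = 1"
    using F c2 fin2 by (simp add: card_Diff_subset finite_subset)
  then obtain w where w: "verts G2 - F2 = {w}"
    by (auto simp: card_1_singleton_iff)
  then have wF: "w \<notin> F2" "verts G2 = insert w F2"
    using F(2) by auto
  define v where "v = \<sigma> w"
  have "\<sigma> w \<notin> \<sigma> ` F2"
    using inj wF by (auto simp: inj_on_def)
  then have v: "v \<notin> F1" "V2' = insert v F1"
    using \<sigma>(3) V2' wF(2) by (auto simp: v_def)
  then have vG: "v \<notin> verts G1"
    using \<sigma>(2) by blast
  have clique: "nsets F1 2 \<subseteq> edges G1"
    using compl by (auto simp: complete_graph_def induced_def)
  have "edges G1 \<union> {{\<sigma> x, \<sigma> y} |x y. {x, y} \<in> edges G2} = edges G1 \<union> (\<lambda>f. {v, f}) ` F1"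
  proof (intro equalityI subsetI)
    fix e assume "e \<in> edges G1 \<union> {{\<sigma> x, \<sigma> y} |x y. {x, y} \<in> edges G2}"
    then consider "e \<in> edges G1" | x y where "e = {\<sigma> x, \<sigma> y}" "{x, y} \<in> edges G2"
      by blast
    then show "e \<in> edges G1 \<union> (\<lambda>f. {v, f}) ` F1"
    proof cases
      case 2
      then have xy: "x \<in> verts G2" "y \<in> verts G2" "x \<noteq> y"
        unfolding e2 by (auto simp: nsets_def card_insert_if)
      then have ne: "\<sigma> x \<noteq> \<sigma> y"
        using inj by (auto simp: inj_on_def)
      have mem: "\<sigma> x \<in> insert v F1" "\<sigma> y \<in> insert v F1"
        unfolding v(2)[symmetric] V2' using xy(1,2) by simp_all
      show ?thesis
      proof (cases "v \<in> {\<sigma> x, \<sigma> y}")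
        case True
        then consider "\<sigma> x = v" "\<sigma> y \<in> F1" | "\<sigma> y = v" "\<sigma> x \<in> F1"
          using ne mem by (metis insert_iff singletonD)
        then show ?thesis
          unfolding 2(1) by cases (simp_all add: insert_commute)
      next
        case False
        then have "e \<in> nsets F1 2"
          using ne mem 2(1) by (auto simp: nsets_def)
        then show ?thesis
          using clique by blast
      qed
    qed simp
  next
    fix e assume "e \<in> edges G1 \<union> (\<lambda>f. {v, f}) ` F1"
    moreover have "{v, f} \<in> {{\<sigma> x, \<sigma> y} |x y. {x, y} \<in> edges G2}" if "f \<in> F1" for f
    proof -
      from that \<sigma>(3) obtain g where g: "g \<in> F2" "f = \<sigma> g"
        by blast
      then have "{w, g} \<in> edges G2"
        using wF unfolding e2 by (auto simp: nsets_def card_insert_if)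
      then show ?thesis
        using g v_def by blast
    qed
    ultimately show "e \<in> edges G1 \<union> {{\<sigma> x, \<sigma> y} |x y. {x, y} \<in> edges G2}"
      by blast
  qed
  moreover have "verts G1 \<union> V2' = insert v (verts G1)"
    using v F(1) by auto
  ultimately have "G = add_vertex v F1 G1"
    unfolding G add_vertex_def by simp
  with that vG F clique show thesis
    by blast
qed

section \<open>Induction on the number of summands\<close>

theorem theorem3p5:
  fixes t n k :: nat
    and K :: "nat \<Rightarrow> 'a sgraph"
    and G :: "'a sgraph"
  assumes "t \<ge> 1" and "n \<ge> 1"
    and "\<forall>i\<in>{1..n}. is_K (t + 1) (K i)"
    and "iterated_connected_sum t n K G"
  shows "bnum k G = (int k - 1) * int (n choose k)"
proof -
  from assms(4) obtain H where H1: "H 1 = K 1" and Hn: "H n = G"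
    and HS: "\<forall>i\<in>{2..n}. connected_sum t (H (i - 1)) (K i) (H i)"
    unfolding iterated_connected_sum_def by blast
  \<comment> \<open>Simplicity is an assumption of the recursion, the vertex count determines its
    binomial term, and the formula is claimed for all \<open>k\<close> because the recursion refers
    to two consecutive indices.\<close>
  have "i \<le> n \<Longrightarrow> simple_graph (H i) \<and> card (verts (H i)) = t + i \<and>
      (\<forall>k. bnum k (H i) = (int k - 1) * int (i choose k))" if "1 \<le> i" for i
    using that
  proof (induction i rule: dec_induct)
    case base
    have "is_K (t + 1) (H 1)"
      using assms(2,3) H1 by simp
    then have *: "complete_graph (H 1)" "card (verts (H 1)) = t + 1"
      by (simp_all add: is_K_def)
    have "bnum k (H 1) = (int k - 1) * int (1 choose k)" for k
    proof (cases "k = 0")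
      case True
      then show ?thesis
        using * bnum_0[of "H 1"] by (simp add: complete_graph_def)
    next
      case False
      \<comment> \<open>For \<open>k = 1\<close> the factor \<open>int k - 1\<close> vanishes, for
        larger \<open>k\<close> the coefficient \<open>1 choose k\<close> does.\<close>
      then show ?thesis
        using bnum_complete_graph[OF *(1)] by (cases "k = 1") (simp_all add: binomial_eq_0)
    qed
    then show ?case
      using * by (simp add: complete_graph_def simple_graph_def)
  next
    case (step i)
    then have IH: "simple_graph (H i)" "card (verts (H i)) = t + i"
      "\<And>k. bnum k (H i) = (int k - 1) * int (i choose k)"
      by auto
    have "Suc i \<in> {2..n}"
      using step by simp
    then have "connected_sum t (H i) (K (Suc i)) (H (Suc i))" "is_K (t + 1) (K (Suc i))"
      using HS assms(3) by fastforce+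
    then obtain v N where vN: "v \<notin> verts (H i)" "N \<subseteq> verts (H i)" "card N = t"
        "nsets N 2 \<subseteq> edges (H i)" and H: "H (Suc i) = add_vertex v N (H i)"
      by (rule connected_sum_complete_graphE)
    note ctx = IH(1) vN(1,2,4)
    have simple: "simple_graph (H (Suc i))"
      unfolding H by (rule simple_graph_add_vertex[OF ctx])
    have "card (verts (H (Suc i))) = t + Suc i"
      using IH(1,2) vN(1) by (simp add: H add_vertex_def simple_graph_def)
    moreover have "bnum k (H (Suc i)) = (int k - 1) * int (Suc i choose k)" for k
    proof (cases k)
      case 0
      then show ?thesis
        using simple by (simp add: bnum_0 simple_graph_def)
    next
      case (Suc j)
      \<comment> \<open>As \<open>t + i - t = i\<close>, the recursion gives
        \<open>j * (i choose Suc j) + (j - 1) * (i choose j) + (i choose j)\<close>, which is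
        \<open>j * (Suc i choose Suc j)\<close> by Pascal's rule.\<close>
      then show ?thesis
        using bnum_add_vertex[OF ctx, of j] IH vN(3)
        by (simp add: H algebra_simps)
    qed
    ultimately show ?case
      using simple by blast
  qed
  then show ?thesis
    using assms(2) Hn by blast
qed

end
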